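(* For every positive integer $n$, the number of isomorphism classes of semisymmetric idempotent Latin squares of order $n$ equals the number of isomorphism classes of semisymmetric unipotent Latin squares of order $n+1$.
   Context: A Latin square of order $n$ is an $n\times n$ array with rows, columns and symbols all indexed by $\{1,\dots,n\}$, each row and column containing every symbol exactly once; equivalently, a set of $n^2$ triples (row, column, symbol) such that distinct triples agree in at most one coordinate. It is semisymmetric if whenever $(a,b,c)$ is one of its triples, so is $(b,c,a)$. It is idempotent if cell $(i,i)$ contains symbol $i$ for every $i$, and unipotent if all cells on the main diagonal contain the same symbol. For $\alpha\in\mathcal{S}_n$, the isomorphism $(\alpha,\alpha,\alpha)$ maps each triple $(r,c,s)$ to $(r^\alpha,c^\alpha,s^\alpha)$; two Latin squares are isomorphic if one is mapped to the other by some isomorphism. *)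

theory Defs
  imports "HOL-Combinatorics.Permutations"
begin

text \<open>A Latin square is represented by its set of (row, column, symbol) triples: every cell holds
  exactly one symbol, and every symbol occurs exactly once in every row and in every column.\<close>

definition latin_square :: "nat \<Rightarrow> (nat \<times> nat \<times> nat) set \<Rightarrow> bool" where
  "latin_square n L \<longleftrightarrow>
     L \<subseteq> {1..n} \<times> {1..n} \<times> {1..n} \<and>
     (\<forall>r\<in>{1..n}. \<forall>c\<in>{1..n}. \<exists>!s. (r, c, s) \<in> L) \<and>
     (\<forall>r\<in>{1..n}. \<forall>s\<in>{1..n}. \<exists>!c. (r, c, s) \<in> L) \<and>
     (\<forall>c\<in>{1..n}. \<forall>s\<in>{1..n}. \<exists>!r. (r, c, s) \<in> L)"

definition semisymmetric :: "(nat \<times> nat \<times> nat) set \<Rightarrow> bool" where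
  "semisymmetric L \<longleftrightarrow> (\<forall>a b c. (a, b, c) \<in> L \<longrightarrow> (b, c, a) \<in> L)"

definition idempotent :: "nat \<Rightarrow> (nat \<times> nat \<times> nat) set \<Rightarrow> bool" where
  "idempotent n L \<longleftrightarrow> (\<forall>i\<in>{1..n}. (i, i, i) \<in> L)"

definition unipotent :: "nat \<Rightarrow> (nat \<times> nat \<times> nat) set \<Rightarrow> bool" where
  "unipotent n L \<longleftrightarrow> (\<exists>s. \<forall>i\<in>{1..n}. (i, i, s) \<in> L)"

definition apply_isomorphism ::
    "(nat \<Rightarrow> nat) \<Rightarrow> (nat \<times> nat \<times> nat) set \<Rightarrow> (nat \<times> nat \<times> nat) set" where
  "apply_isomorphism \<alpha> L = (\<lambda>(r, c, s). (\<alpha> r, \<alpha> c, \<alpha> s)) ` L"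

definition isomorphism_rel ::
    "nat \<Rightarrow> ((nat \<times> nat \<times> nat) set \<times> (nat \<times> nat \<times> nat) set) set" where
  "isomorphism_rel n =
     {(L, M). latin_square n L \<and> latin_square n M \<and>
              (\<exists>\<alpha>. \<alpha> permutes {1..n} \<and> M = apply_isomorphism \<alpha> L)}"

end

theory Submission
  imports Defs
begin

text \<open>In a semisymmetric unipotent Latin square the diagonal symbol \<open>e\<close> is a two-sided identity,
  since \<open>(i, i, e)\<close> rotates to \<open>(i, e, i)\<close> and \<open>(e, i, i)\<close>. After moving \<open>e\<close> to \<open>n + 1\<close> by a
  transposition, deleting row, column and symbol \<open>e\<close> leaves only the diagonal cells empty, and
  filling them idempotently gives a semisymmetric idempotent square of order \<open>n\<close>. The inverse
  operation is prolongation along the main diagonal. Every isomorphism between unipotent squares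
  maps the diagonal symbol to the diagonal symbol, so both operations respect isomorphism.\<close>

section \<open>Prolongation and contraction on sets of triples\<close>

text \<open>The added triples are the three rotations of \<open>(i, i, n + 1)\<close>, so
  \<open>n + 1\<close> becomes both the diagonal symbol and a two-sided identity. For
  \<open>i = n + 1\<close> the three coincide and fill the corner cell.\<close>

definition prolongation :: "nat \<Rightarrow> (nat \<times> nat \<times> nat) set \<Rightarrow> (nat \<times> nat \<times> nat) set" where
  "prolongation n L = (L - (\<lambda>i. (i, i, i)) ` {1..n}) \<union>
     (\<Union>i\<in>{1..n + 1}. {(i, i, n + 1), (i, n + 1, i), (n + 1, i, i)})"

definition contraction :: "nat \<Rightarrow> (nat \<times> nat \<times> nat) set \<Rightarrow> (nat \<times> nat \<times> nat) set" where
  "contraction n M = M \<inter> ({1..n} \<times> {1..n} \<times> {1..n}) - {(a, b, c). a = b} \<union>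
     (\<lambda>i. (i, i, i)) ` {1..n}"

lemma mem_prolongation_iff:
  "(a, b, c) \<in> prolongation n L \<longleftrightarrow>
     (a, b, c) \<in> L \<and> \<not> (a = b \<and> b = c \<and> a \<in> {1..n}) \<or>
     a \<in> {1..n + 1} \<and> b = a \<and> c = n + 1 \<or>
     a \<in> {1..n + 1} \<and> c = a \<and> b = n + 1 \<or>
     b \<in> {1..n + 1} \<and> c = b \<and> a = n + 1"
  by (auto simp: prolongation_def)

lemma mem_contraction_iff:
  "(a, b, c) \<in> contraction n M \<longleftrightarrow>
     (a, b, c) \<in> M \<and> a \<in> {1..n} \<and> b \<in> {1..n} \<and> c \<in> {1..n} \<and> a \<noteq> b \<or>
     a \<in> {1..n} \<and> b = a \<and> c = a"
  by (auto simp: contraction_def)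

section \<open>Latin squares and the rotation of triples\<close>

lemma latin_square_mem:
  assumes "latin_square n L" "(a, b, c) \<in> L"
  shows "a \<in> {1..n}" "b \<in> {1..n}" "c \<in> {1..n}"
proof -
  have "L \<subseteq> {1..n} \<times> {1..n} \<times> {1..n}"
    using assms(1) unfolding latin_square_def by (rule conjunct1)
  then show "a \<in> {1..n}" "b \<in> {1..n}" "c \<in> {1..n}"
    using assms(2) by blast+
qed

lemma latin_square_symbol_ex1:
  assumes "latin_square n L" "a \<in> {1..n}" "b \<in> {1..n}"
  shows "\<exists>!c. (a, b, c) \<in> L"
proof -
  have "\<forall>r\<in>{1..n}. \<forall>c\<in>{1..n}. \<exists>!s. (r, c, s) \<in> L"
    using assms(1) unfolding latin_square_def by (elim conjE)
  then show ?thesis using assms(2,3) by (elim ballE) (assumption | erule notE)+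
qed

lemma latin_square_column_ex1:
  assumes "latin_square n L" "a \<in> {1..n}" "c \<in> {1..n}"
  shows "\<exists>!b. (a, b, c) \<in> L"
proof -
  have "\<forall>r\<in>{1..n}. \<forall>s\<in>{1..n}. \<exists>!c. (r, c, s) \<in> L"
    using assms(1) unfolding latin_square_def by (elim conjE)
  then show ?thesis using assms(2,3) by (elim ballE) (assumption | erule notE)+
qed

lemma latin_square_symbol_unique:
  assumes "latin_square n L" "(a, b, c) \<in> L" "(a, b, d) \<in> L"
  shows "c = d"
  using latin_square_symbol_ex1[OF assms(1) latin_square_mem(1,2)[OF assms(1,2)]] assms(2,3)
  by (elim ex1E) blast

lemma latin_square_column_unique:
  assumes "latin_square n L" "(a, b, c) \<in> L" "(a, d, c) \<in> L"
  shows "b = d"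
  using latin_square_column_ex1[OF assms(1) latin_square_mem(1,3)[OF assms(1,2)]] assms(2,3)
  by (elim ex1E) blast

lemma latin_square_symbol_exists:
  assumes "latin_square n L" "a \<in> {1..n}" "b \<in> {1..n}"
  obtains c where "(a, b, c) \<in> L"
  using latin_square_symbol_ex1[OF assms] by (elim ex1E) blast

text \<open>Three rotations compose to the identity, so the one-way implication reverses by applying
  it twice more.\<close>

lemma semisymmetric_rotate:
  assumes "semisymmetric L"
  shows "(b, c, a) \<in> L \<longleftrightarrow> (a, b, c) \<in> L"
  using assms unfolding semisymmetric_def by meson

text \<open>Rotation turns the condition on cells into the conditions on rows and on columns, and
  brings every coordinate to the front, where \<open>range\<close> bounds it.\<close>

lemma semisymmetric_latin_squareI:
  assumes ss: "semisymmetric L"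
    and range: "\<And>a b c. (a, b, c) \<in> L \<Longrightarrow> a \<in> {1..n}"
    and ex: "\<And>a b. a \<in> {1..n} \<Longrightarrow> b \<in> {1..n} \<Longrightarrow> \<exists>c. (a, b, c) \<in> L"
    and uniq: "\<And>a b c d. (a, b, c) \<in> L \<Longrightarrow> (a, b, d) \<in> L \<Longrightarrow> c = d"
  shows "latin_square n L"
proof -
  have rot: "(b, c, a) \<in> L \<longleftrightarrow> (a, b, c) \<in> L" for a b c
    by (rule semisymmetric_rotate[OF ss])
  have ex1: "\<exists>!c. (a, b, c) \<in> L" if "a \<in> {1..n}" "b \<in> {1..n}" for a b
    using ex[OF that] uniq by blast
  have "L \<subseteq> {1..n} \<times> {1..n} \<times> {1..n}"
  proof
    fix t assume "t \<in> L"
    moreover obtain a b c where t: "t = (a, b, c)" by (rule prod_cases3)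
    ultimately have "(a, b, c) \<in> L" "(b, c, a) \<in> L" "(c, a, b) \<in> L"
      using rot by blast+
    then have "a \<in> {1..n}" "b \<in> {1..n}" "c \<in> {1..n}"
      using range by blast+
    then show "t \<in> {1..n} \<times> {1..n} \<times> {1..n}"
      unfolding t by blast
  qed
  \<comment> \<open>By rotation, the column of symbol \<open>s\<close> in row \<open>r\<close> is
    the symbol in cell \<open>(s, r)\<close>; likewise below, the row of \<open>s\<close> in column
    \<open>c\<close> is the symbol in cell \<open>(c, s)\<close>.\<close>
  moreover have "\<exists>!c. (r, c, s) \<in> L" if "r \<in> {1..n}" "s \<in> {1..n}" for r s
    using ex1[OF that(2,1)] unfolding rot[of r _ s] .
  moreover have "\<exists>!r. (r, c, s) \<in> L" if "c \<in> {1..n}" "s \<in> {1..n}" for c s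
    using ex1[OF that] unfolding rot[of c s] .
  ultimately show ?thesis
    using ex1 unfolding latin_square_def by (intro conjI ballI)
qed

section \<open>Action of permutations on Latin squares\<close>

lemma mem_apply_isomorphism_iff:
  assumes "bij \<alpha>"
  shows "(a, b, c) \<in> apply_isomorphism \<alpha> L \<longleftrightarrow> (inv \<alpha> a, inv \<alpha> b, inv \<alpha> c) \<in> L"
proof
  assume "(a, b, c) \<in> apply_isomorphism \<alpha> L"
  then show "(inv \<alpha> a, inv \<alpha> b, inv \<alpha> c) \<in> L"
    using assms by (auto simp: apply_isomorphism_def bij_is_inj)
next
  assume "(inv \<alpha> a, inv \<alpha> b, inv \<alpha> c) \<in> L"
  then have "(\<alpha> (inv \<alpha> a), \<alpha> (inv \<alpha> b), \<alpha> (inv \<alpha> c)) \<in> apply_isomorphism \<alpha> L"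
    unfolding apply_isomorphism_def by force
  then show "(a, b, c) \<in> apply_isomorphism \<alpha> L"
    using assms by (simp add: bij_is_surj surj_f_inv_f)
qed

lemma apply_isomorphism_compose:
  "apply_isomorphism \<alpha> (apply_isomorphism \<beta> L) = apply_isomorphism (\<alpha> \<circ> \<beta>) L"
  unfolding apply_isomorphism_def image_image by (rule image_cong) auto

lemma apply_isomorphism_id: "apply_isomorphism id L = L"
  unfolding apply_isomorphism_def by simp

lemma semisymmetric_apply_isomorphism:
  assumes "semisymmetric L"
  shows "semisymmetric (apply_isomorphism \<alpha> L)"
  unfolding semisymmetric_def
proof (intro allI impI)
  fix a b c assume "(a, b, c) \<in> apply_isomorphism \<alpha> L"
  then obtain x y z where "(x, y, z) \<in> L" "a = \<alpha> x" "b = \<alpha> y" "c = \<alpha> z"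
    by (auto simp: apply_isomorphism_def)
  moreover from this have "(y, z, x) \<in> L"
    using assms by (simp add: semisymmetric_def)
  ultimately show "(b, c, a) \<in> apply_isomorphism \<alpha> L"
    unfolding apply_isomorphism_def by force
qed

text \<open>Relabelled squares have to be known to be Latin before contraction can be applied to
  them. Cell \<open>(a, b)\<close> of the image takes its symbol from cell
  \<open>(inv \<alpha> a, inv \<alpha> b)\<close> of \<open>L\<close>.\<close>

lemma semisymmetric_latin_square_apply_isomorphism:
  assumes L: "latin_square n L" "semisymmetric L" and \<alpha>: "\<alpha> permutes {1..n}"
  shows "latin_square n (apply_isomorphism \<alpha> L)"
proof (rule semisymmetric_latin_squareI)
  have mem: "(a, b, c) \<in> apply_isomorphism \<alpha> L \<longleftrightarrow> (inv \<alpha> a, inv \<alpha> b, inv \<alpha> c) \<in> L" for a b c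
    by (rule mem_apply_isomorphism_iff[OF permutes_bij[OF \<alpha>]])
  have in_inv: "inv \<alpha> a \<in> {1..n} \<longleftrightarrow> a \<in> {1..n}" for a
    by (rule permutes_in_image[OF permutes_inv[OF \<alpha>]])
  show "semisymmetric (apply_isomorphism \<alpha> L)"
    by (rule semisymmetric_apply_isomorphism[OF L(2)])
  show "a \<in> {1..n}" if "(a, b, c) \<in> apply_isomorphism \<alpha> L" for a b c
    using that latin_square_mem(1)[OF L(1)] in_inv unfolding mem by blast
  show "\<exists>c. (a, b, c) \<in> apply_isomorphism \<alpha> L" if "a \<in> {1..n}" "b \<in> {1..n}" for a b
  proof -
    have "inv \<alpha> a \<in> {1..n}" "inv \<alpha> b \<in> {1..n}"
      using that in_inv by blast+
    then obtain c where "(inv \<alpha> a, inv \<alpha> b, c) \<in> L"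
      by (rule latin_square_symbol_exists[OF L(1)])
    then have "(a, b, \<alpha> c) \<in> apply_isomorphism \<alpha> L"
      unfolding mem using permutes_inverses(2)[OF \<alpha>] by simp
    then show ?thesis ..
  qed
  show "c = d" if "(a, b, c) \<in> apply_isomorphism \<alpha> L" "(a, b, d) \<in> apply_isomorphism \<alpha> L" for a b c d
    using that latin_square_symbol_unique[OF L(1)] permutes_inverses(1)[OF \<alpha>] unfolding mem by metis
qed

lemma equiv_isomorphism_rel: "equiv {L. latin_square n L} (isomorphism_rel n)"
proof (rule equivI)
  show "isomorphism_rel n \<subseteq> {L. latin_square n L} \<times> {L. latin_square n L}"
    by (auto simp: isomorphism_rel_def)
  show "refl_on {L. latin_square n L} (isomorphism_rel n)"
  proof (rule refl_onI)
    fix L assume "L \<in> {L. latin_square n L}"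
    then show "(L, L) \<in> isomorphism_rel n"
      using permutes_id[of "{1..n}"] apply_isomorphism_id[of L, symmetric]
      unfolding isomorphism_rel_def by blast
  qed
  show "sym (isomorphism_rel n)"
  proof (rule symI)
    fix L M assume "(L, M) \<in> isomorphism_rel n"
    then obtain \<alpha> where *: "latin_square n L" "latin_square n M" "\<alpha> permutes {1..n}"
      "M = apply_isomorphism \<alpha> L" by (auto simp: isomorphism_rel_def)
    then have "L = apply_isomorphism (inv \<alpha>) M"
      by (simp add: apply_isomorphism_compose permutes_inv_o apply_isomorphism_id)
    then show "(M, L) \<in> isomorphism_rel n"
      using * permutes_inv[OF *(3)] by (auto simp: isomorphism_rel_def)
  qed
  show "trans (isomorphism_rel n)"
  proof (rule transI)
    fix L M N assume "(L, M) \<in> isomorphism_rel n" "(M, N) \<in> isomorphism_rel n"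
    then show "(L, N) \<in> isomorphism_rel n"
      by (auto simp: isomorphism_rel_def apply_isomorphism_compose intro: permutes_compose)
  qed
qed

section \<open>Counting classes through a map of representatives\<close>

text \<open>A map that preserves and reflects the relations and meets every class up to
  \<open>S\<close> induces a bijection between the sets of classes.\<close>

lemma card_quotient_eq_if_equivalence:
  assumes R: "equiv X R" "A \<subseteq> X" and S: "equiv Y S" "B \<subseteq> Y"
    and f: "\<And>x. x \<in> A \<Longrightarrow> f x \<in> B"
    and iff: "\<And>x y. x \<in> A \<Longrightarrow> y \<in> A \<Longrightarrow> (f x, f y) \<in> S \<longleftrightarrow> (x, y) \<in> R"
    and ess_surj: "\<And>y. y \<in> B \<Longrightarrow> \<exists>x\<in>A. (f x, y) \<in> S"
  shows "card (A // R) = card (B // S)"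
proof -
  \<comment> \<open>All members of the class are mapped at once, so no representative is chosen. The
    intersection with \<open>A\<close> is there because a class may leave \<open>A\<close>, where
    nothing is known about \<open>f\<close>.\<close>
  define g where "g C = S `` (f ` (C \<inter> A))" for C
  have g: "g (R `` {x}) = S `` {f x}" if "x \<in> A" for x
  proof -
    have "S `` {f z} = S `` {f x}" if "z \<in> R `` {x} \<inter> A" for z
      using that \<open>x \<in> A\<close> iff equiv_class_eq[OF S(1)] by blast
    moreover have "x \<in> R `` {x} \<inter> A"
      using that R equiv_class_self by fast
    ultimately show ?thesis
      unfolding g_def by blast
  qed
  have "inj_on g (A // R)"
  proof (rule inj_onI)
    fix C D assume "C \<in> A // R" "D \<in> A // R" and eq: "g C = g D"
    then obtain x y where *: "x \<in> A" "y \<in> A" "C = R `` {x}" "D = R `` {y}"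
      by (auto simp: quotient_def)
    then have "S `` {f x} = S `` {f y}"
      using eq g by simp
    then have "(f x, f y) \<in> S"
      using eq_equiv_class[OF _ S(1)] f[OF *(2)] S(2) by blast
    then show "C = D"
      using * iff equiv_class_eq[OF R(1)] by simp
  qed
  moreover have "g ` (A // R) = B // S"
  proof
    show "g ` (A // R) \<subseteq> B // S"
      using g f by (auto simp: quotient_def)
    show "B // S \<subseteq> g ` (A // R)"
    proof
      fix D assume "D \<in> B // S"
      then obtain y where "y \<in> B" "D = S `` {y}"
        by (auto simp: quotient_def)
      moreover obtain x where "x \<in> A" "(f x, y) \<in> S"
        using ess_surj[OF \<open>y \<in> B\<close>] by blast
      ultimately have "D = g (R `` {x})"
        using g equiv_class_eq[OF S(1)] by simp
      then show "D \<in> g ` (A // R)"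
        using \<open>x \<in> A\<close> by (auto simp: quotient_def)
    qed
  qed
  ultimately show ?thesis
    by (metis card_image)
qed

section \<open>Prolongation of idempotent squares\<close>

lemma semisymmetric_prolongation:
  assumes "semisymmetric L"
  shows "semisymmetric (prolongation n L)"
  unfolding semisymmetric_def
proof (intro allI impI)
  fix a b c assume "(a, b, c) \<in> prolongation n L"
  moreover have "(a, b, c) \<in> L \<longrightarrow> (b, c, a) \<in> L"
    using assms by (simp add: semisymmetric_def)
  ultimately show "(b, c, a) \<in> prolongation n L"
    unfolding mem_prolongation_iff by (elim disjE) auto
qed

lemma prolongation_diagonal:
  "i \<in> {1..n + 1} \<Longrightarrow> (i, i, n + 1) \<in> prolongation n L"
  by (simp add: mem_prolongation_iff)

lemma latin_square_prolongation:
  assumes L: "latin_square n L" "semisymmetric L" "idempotent n L"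
  shows "latin_square (n + 1) (prolongation n L)"
proof (rule semisymmetric_latin_squareI)
  \<comment> \<open>Idempotence and uniqueness show that deleting the triples
    \<open>(i, i, i)\<close> empties the diagonal cells completely.\<close>
  have diag: "c = a" if "(a, a, c) \<in> L" for a c
    using that L latin_square_mem[OF L(1) that] latin_square_symbol_unique[OF L(1)]
    unfolding idempotent_def by blast
  show "semisymmetric (prolongation n L)"
    by (rule semisymmetric_prolongation[OF L(2)])
  show "a \<in> {1..n + 1}" if "(a, b, c) \<in> prolongation n L" for a b c
    using that latin_square_mem[OF L(1)] by (fastforce simp: mem_prolongation_iff)
  show "\<exists>c. (a, b, c) \<in> prolongation n L" if "a \<in> {1..n + 1}" "b \<in> {1..n + 1}" for a b
  \<comment> \<open>Diagonal and border cells are filled by the new triples, all other cells by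
    \<open>L\<close>.\<close>
  proof (cases "a = b \<or> a = n + 1 \<or> b = n + 1")
    case True
    then show ?thesis using that unfolding mem_prolongation_iff by blast
  next
    case False
    then have "a \<in> {1..n}" "b \<in> {1..n}" using that by auto
    then obtain c where "(a, b, c) \<in> L" by (rule latin_square_symbol_exists[OF L(1)])
    then show ?thesis using False unfolding mem_prolongation_iff by blast
  qed
  show "c = d" if "(a, b, c) \<in> prolongation n L" "(a, b, d) \<in> prolongation n L" for a b c d
  proof -
    \<comment> \<open>An entry of \<open>L\<close> never involves \<open>n + 1\<close>, and on the
      diagonal it is one of the deleted triples; hence old and new entries never share a
      cell.\<close>
    have mem: "c \<in> {1..n} \<and> a \<in> {1..n} \<and> b \<in> {1..n} \<and> (a = b \<longrightarrow> c = a)" if "(a, b, c) \<in> L" for c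
      using latin_square_mem[OF L(1) that] diag that by blast
    show ?thesis
      using that mem[of c] mem[of d] latin_square_symbol_unique[OF L(1), of a b c d]
      unfolding mem_prolongation_iff by auto
  qed
qed

text \<open>This left inverse makes prolongation injective on idempotent Latin squares; it serves
  below to cancel prolongations.\<close>

lemma contraction_prolongation:
  assumes "latin_square n L" "idempotent n L"
  shows "contraction n (prolongation n L) = L"
proof -
  have "(a, b, c) \<in> contraction n (prolongation n L) \<longleftrightarrow> (a, b, c) \<in> L" for a b c
  proof
    assume "(a, b, c) \<in> contraction n (prolongation n L)"
    then show "(a, b, c) \<in> L"
      using assms(2) by (auto simp: mem_prolongation_iff mem_contraction_iff idempotent_def)
  next
    assume abc: "(a, b, c) \<in> L"
    note mem = latin_square_mem[OF assms(1) abc]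
    have "c = a" if "a = b"
      using abc mem assms(2) latin_square_symbol_unique[OF assms(1)] that
      unfolding idempotent_def by blast
    then show "(a, b, c) \<in> contraction n (prolongation n L)"
      using abc mem by (cases "a = b") (auto simp: mem_prolongation_iff mem_contraction_iff)
  qed
  then show ?thesis by auto
qed

text \<open>Apart from \<open>L\<close>, prolongation refers only to \<open>n + 1\<close>,
  \<open>{1..n}\<close> and \<open>{1..n + 1}\<close>, all preserved by \<open>\<alpha>\<close>, so
  it commutes with relabelling.\<close>

lemma prolongation_apply_isomorphism:
  assumes \<alpha>: "\<alpha> permutes {1..n}"
  shows "apply_isomorphism \<alpha> (prolongation n L) = prolongation n (apply_isomorphism \<alpha> L)"
proof -
  have inv\<alpha>: "inv \<alpha> permutes {1..n}" by (rule permutes_inv[OF \<alpha>])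
  then have inv\<alpha>': "inv \<alpha> permutes {1..n + 1}" by (rule permutes_subset) auto
  have fixed: "inv \<alpha> (n + 1) = n + 1" by (rule permutes_not_in[OF inv\<alpha>]) simp
  have eq: "inv \<alpha> x = inv \<alpha> y \<longleftrightarrow> x = y" for x y
    using permutes_inj[OF inv\<alpha>] by (simp add: inj_eq)
  have eq': "inv \<alpha> x = n + 1 \<longleftrightarrow> x = n + 1" for x
    using eq[of x "n + 1"] unfolding fixed .
  have "(a, b, c) \<in> apply_isomorphism \<alpha> (prolongation n L) \<longleftrightarrow>
        (a, b, c) \<in> prolongation n (apply_isomorphism \<alpha> L)" for a b c
    unfolding mem_apply_isomorphism_iff[OF permutes_bij[OF \<alpha>]] mem_prolongation_iff
      permutes_in_image[OF inv\<alpha>] permutes_in_image[OF inv\<alpha>'] eq eq' by (rule refl)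
  then show ?thesis by auto
qed

lemma isomorphism_rel_prolongation_iff:
  assumes L: "latin_square n L" "semisymmetric L" "idempotent n L"
    and M: "latin_square n M" "semisymmetric M" "idempotent n M"
  shows "(prolongation n L, prolongation n M) \<in> isomorphism_rel (n + 1) \<longleftrightarrow>
         (L, M) \<in> isomorphism_rel n"
proof
  assume "(L, M) \<in> isomorphism_rel n"
  then obtain \<alpha> where \<alpha>: "\<alpha> permutes {1..n}" "M = apply_isomorphism \<alpha> L"
    by (auto simp: isomorphism_rel_def)
  \<comment> \<open>The same function serves for order \<open>n + 1\<close>, since it already fixes
    every point outside \<open>{1..n}\<close>.\<close>
  then have "\<alpha> permutes {1..n + 1}" by (auto intro: permutes_subset)
  then show "(prolongation n L, prolongation n M) \<in> isomorphism_rel (n + 1)"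
    using \<alpha> latin_square_prolongation[OF L] latin_square_prolongation[OF M]
    by (auto simp: isomorphism_rel_def prolongation_apply_isomorphism)
next
  assume "(prolongation n L, prolongation n M) \<in> isomorphism_rel (n + 1)"
  then obtain \<beta> where \<beta>: "\<beta> permutes {1..n + 1}"
    and eq: "prolongation n M = apply_isomorphism \<beta> (prolongation n L)"
    by (auto simp: isomorphism_rel_def)
  \<comment> \<open>The diagonal symbol must be fixed: cell
    \<open>(\<beta> (n + 1), \<beta> (n + 1))\<close> of the prolongation of \<open>M\<close> holds
    \<open>\<beta> (n + 1)\<close>, as the image of the corner triple, and \<open>n + 1\<close>, as
    every diagonal cell does.\<close>
  have "(n + 1, n + 1, n + 1) \<in> prolongation n L"
    by (rule prolongation_diagonal) simp
  then have "(\<beta> (n + 1), \<beta> (n + 1), \<beta> (n + 1)) \<in> prolongation n M"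
    unfolding eq apply_isomorphism_def by force
  moreover have "(\<beta> (n + 1), \<beta> (n + 1), n + 1) \<in> prolongation n M"
    by (rule prolongation_diagonal) (simp only: permutes_in_image[OF \<beta>], simp)
  ultimately have fixed: "\<beta> (n + 1) = n + 1"
    by (rule latin_square_symbol_unique[OF latin_square_prolongation[OF M]])
  have \<beta>': "\<beta> permutes {1..n}"
  proof (rule permutes_superset[OF \<beta>])
    fix x assume "x \<in> {1..n + 1} - {1..n}"
    then have "x = n + 1" by auto
    then show "\<beta> x = x" using fixed by simp
  qed
  have lat: "latin_square n (apply_isomorphism \<beta> L)"
    by (rule semisymmetric_latin_square_apply_isomorphism[OF L(1,2) \<beta>'])
  have idem: "idempotent n (apply_isomorphism \<beta> L)"
    using L(3) permutes_in_image[OF permutes_inv[OF \<beta>']]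
    unfolding idempotent_def mem_apply_isomorphism_iff[OF permutes_bij[OF \<beta>]] by blast
  \<comment> \<open>Since \<open>\<beta>\<close> also permutes \<open>{1..n}\<close>, it can be
    moved inside the prolongation, which contraction then cancels on both sides.\<close>
  have "M = contraction n (prolongation n M)"
    by (rule contraction_prolongation[OF M(1,3), symmetric])
  also have "\<dots> = contraction n (prolongation n (apply_isomorphism \<beta> L))"
    unfolding eq prolongation_apply_isomorphism[OF \<beta>'] ..
  also have "\<dots> = apply_isomorphism \<beta> L"
    by (rule contraction_prolongation[OF lat idem])
  finally show "(L, M) \<in> isomorphism_rel n"
    using L(1) M(1) \<beta>' by (auto simp: isomorphism_rel_def)
qed

section \<open>Contraction of unipotent squares\<close>

lemma unipotent_contraction:
  assumes M: "latin_square (n + 1) M" "semisymmetric M"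
    and uni: "\<And>i. i \<in> {1..n + 1} \<Longrightarrow> (i, i, n + 1) \<in> M"
  shows "latin_square n (contraction n M)" "semisymmetric (contraction n M)"
    "idempotent n (contraction n M)" "prolongation n (contraction n M) = M"
proof -
  note rot = semisymmetric_rotate[OF M(2)]
  note symbol_unique = latin_square_symbol_unique[OF M(1)]
  have mem: "a \<in> {1..n + 1} \<and> b \<in> {1..n + 1} \<and> c \<in> {1..n + 1}" if "(a, b, c) \<in> M" for a b c
    using latin_square_mem[OF M(1) that] by blast
  \<comment> \<open>Symbol \<open>n + 1\<close> occupies exactly the diagonal: each diagonal cell
    holds it, and row \<open>a\<close> contains it only in column \<open>a\<close>.\<close>
  have s: "a = b \<longleftrightarrow> c = n + 1" if "(a, b, c) \<in> M" for a b c
  proof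
    show "c = n + 1" if "a = b"
      using that \<open>(a, b, c) \<in> M\<close> mem uni symbol_unique by blast
    show "a = b" if "c = n + 1"
      using that \<open>(a, b, c) \<in> M\<close> mem uni latin_square_column_unique[OF M(1)] by blast
  qed
  \<comment> \<open>These are the rotations of \<open>s\<close>: two coordinates of an entry agree
    exactly when the third is \<open>n + 1\<close>.\<close>
  have M_iff: "b = c \<longleftrightarrow> a = n + 1" "c = a \<longleftrightarrow> b = n + 1" if "(a, b, c) \<in> M" for a b c
    using that rot s by blast+
  show ss: "semisymmetric (contraction n M)"
    unfolding semisymmetric_def mem_contraction_iff
  proof (intro allI impI)
    fix a b c
    assume *: "(a, b, c) \<in> M \<and> a \<in> {1..n} \<and> b \<in> {1..n} \<and> c \<in> {1..n} \<and> a \<noteq> b \<or>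
      a \<in> {1..n} \<and> b = a \<and> c = a"
    show "(b, c, a) \<in> M \<and> b \<in> {1..n} \<and> c \<in> {1..n} \<and> a \<in> {1..n} \<and> b \<noteq> c \<or>
      b \<in> {1..n} \<and> c = b \<and> a = b"
      \<comment> \<open>For an entry of \<open>M\<close>, \<open>a \<noteq> n + 1\<close> forces
        \<open>b \<noteq> c\<close>, so the rotated triple is off the diagonal as well.\<close>
      using * rot[of b c a] M_iff(1)[of a b c] by auto
  qed
  show "idempotent n (contraction n M)"
    by (simp add: idempotent_def mem_contraction_iff)
  show "latin_square n (contraction n M)"
  proof (rule semisymmetric_latin_squareI[OF ss])
    show "a \<in> {1..n}" if "(a, b, c) \<in> contraction n M" for a b c
      using that unfolding mem_contraction_iff by blast
    show "\<exists>c. (a, b, c) \<in> contraction n M" if "a \<in> {1..n}" "b \<in> {1..n}" for a b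
    proof (cases "a = b")
      case True
      then show ?thesis using that unfolding mem_contraction_iff by blast
    next
      case False
      have "a \<in> {1..n + 1}" "b \<in> {1..n + 1}" using that by auto
      then obtain c where c: "(a, b, c) \<in> M" by (rule latin_square_symbol_exists[OF M(1)])
      then have "c \<in> {1..n}" using False s[OF c] mem[OF c] by auto
      then show ?thesis using c False that unfolding mem_contraction_iff by blast
    qed
    show "c = d" if "(a, b, c) \<in> contraction n M" "(a, b, d) \<in> contraction n M" for a b c d
      using that symbol_unique unfolding mem_contraction_iff by blast
  qed
  have "(a, b, c) \<in> prolongation n (contraction n M) \<longleftrightarrow> (a, b, c) \<in> M" for a b c
  proof
    assume "(a, b, c) \<in> prolongation n (contraction n M)"
    then show "(a, b, c) \<in> M"
      \<comment> \<open>The restored border and diagonal triples are rotations of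
        \<open>(i, i, n + 1)\<close>; the idempotent triples inserted by contraction are deleted
        again.\<close>
      using uni rot unfolding mem_prolongation_iff mem_contraction_iff by blast
  next
    assume abc: "(a, b, c) \<in> M"
    have le: "x \<in> {1..n} \<longleftrightarrow> x \<noteq> n + 1" if "x \<in> {1..n + 1}" for x
      using that by auto
    show "(a, b, c) \<in> prolongation n (contraction n M)"
      \<comment> \<open>An entry with a coordinate \<open>n + 1\<close> is one of the added triples;
        otherwise its coordinates are pairwise distinct and it survives contraction.\<close>
      using abc s[OF abc] M_iff[OF abc] mem[OF abc] le[of a] le[of b] le[of c]
      unfolding mem_prolongation_iff mem_contraction_iff by blast
  qed
  then show "prolongation n (contraction n M) = M" by auto
qed

text \<open>Supplies the surjectivity on classes: the diagonal symbol \<open>e\<close> may be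
  arbitrary, but relabelling makes it \<open>n + 1\<close>, and then contraction yields the required
  square.\<close>

lemma unipotent_isomorphic_prolongation:
  assumes M: "latin_square (n + 1) M" "semisymmetric M" "unipotent (n + 1) M"
  shows "\<exists>L. latin_square n L \<and> semisymmetric L \<and> idempotent n L \<and>
    (prolongation n L, M) \<in> isomorphism_rel (n + 1)"
proof -
  obtain e where e: "\<And>i. i \<in> {1..n + 1} \<Longrightarrow> (i, i, e) \<in> M"
    using M(3) unfolding unipotent_def by blast
  have "(n + 1, n + 1, e) \<in> M" by (rule e) simp
  then have e_mem: "e \<in> {1..n + 1}" by (rule latin_square_mem(3)[OF M(1)])
  \<comment> \<open>If \<open>e\<close> is already \<open>n + 1\<close>, this is the
    identity.\<close>
  define \<tau> where "\<tau> = transpose e (n + 1)"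
  have \<tau>: "\<tau> permutes {1..n + 1}"
    unfolding \<tau>_def by (rule permutes_swap_id[OF e_mem]) simp
  define N where "N = apply_isomorphism \<tau> M"
  have N: "latin_square (n + 1) N" "semisymmetric N"
    unfolding N_def using semisymmetric_latin_square_apply_isomorphism[OF M(1,2) \<tau>]
      semisymmetric_apply_isomorphism[OF M(2)] by auto
  have uni: "(i, i, n + 1) \<in> N" if "i \<in> {1..n + 1}" for i
  proof -
    have "inv \<tau> (n + 1) = e" by (simp add: \<tau>_def)
    moreover have "inv \<tau> i \<in> {1..n + 1}"
      using that permutes_in_image[OF permutes_inv[OF \<tau>]] by blast
    ultimately show ?thesis
      unfolding N_def mem_apply_isomorphism_iff[OF permutes_bij[OF \<tau>]] using e by simp
  qed
  have "(M, N) \<in> isomorphism_rel (n + 1)"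
    using M(1) N(1) \<tau> N_def by (auto simp: isomorphism_rel_def)
  then have "(N, M) \<in> isomorphism_rel (n + 1)"
    using equiv_isomorphism_rel unfolding equiv_def sym_def by blast
  then show ?thesis
    \<comment> \<open>The witness is \<open>contraction n N\<close>, whose prolongation is
      \<open>N\<close> itself.\<close>
    using unipotent_contraction[OF N uni] by metis
qed

theorem theorem12:
  fixes n :: nat
  assumes "n \<ge> 1"
  shows "card ({L. latin_square n L \<and> semisymmetric L \<and> idempotent n L} // isomorphism_rel n) =
         card ({L. latin_square (n + 1) L \<and> semisymmetric L \<and> unipotent (n + 1) L}
                 // isomorphism_rel (n + 1))"
proof (rule card_quotient_eq_if_equivalence[OF equiv_isomorphism_rel _ equiv_isomorphism_rel,
    where f = "prolongation n"])
  fix L assume "L \<in> {L. latin_square n L \<and> semisymmetric L \<and> idempotent n L}"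
  then show "prolongation n L \<in>
      {L. latin_square (n + 1) L \<and> semisymmetric L \<and> unipotent (n + 1) L}"
    \<comment> \<open>The witness for \<open>unipotent\<close> is the symbol
      \<open>n + 1\<close>.\<close>
    using latin_square_prolongation semisymmetric_prolongation prolongation_diagonal
    unfolding unipotent_def by blast
next
  fix M assume "M \<in> {L. latin_square (n + 1) L \<and> semisymmetric L \<and> unipotent (n + 1) L}"
  then show "\<exists>L\<in>{L. latin_square n L \<and> semisymmetric L \<and> idempotent n L}.
      (prolongation n L, M) \<in> isomorphism_rel (n + 1)"
    using unipotent_isomorphic_prolongation by blast
next
  fix L M
  assume "L \<in> {L. latin_square n L \<and> semisymmetric L \<and> idempotent n L}"
    "M \<in> {L. latin_square n L \<and> semisymmetric L \<and> idempotent n L}"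
  then show "(prolongation n L, prolongation n M) \<in> isomorphism_rel (n + 1) \<longleftrightarrow>
      (L, M) \<in> isomorphism_rel n"
    by (intro isomorphism_rel_prolongation_iff) auto
qed auto

end
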